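(* Let $\psi(d,g)$ be convex in $g$, and for $t=0,\dots,T-1$ let $Q_t$ be the state-action function of the ramp-constrained dispatch problem defined in the context. For each $t$ let $S_t(\hat{\mathbf d}_t)\in\operatorname{argmin}_{g_t\in\mathbb R}Q_t(\hat{\mathbf d}_t,g_t)$ be an unconstrained minimizer of the $Q$ function with respect to the action. Then the threshold policy $g_t=\mu_t^\star(\hat{\mathbf d}_t,g_{t-1})$, $t=0,\dots,T-1$, with $$\mu_t^\star(\hat{\mathbf d}_t,g_{t-1})=\begin{cases}S_t(\hat{\mathbf d}_t) & \text{if } (g_{t-1}-\underline r)^+\le S_t(\hat{\mathbf d}_t)\le g_{t-1}+\overline r,\\ (g_{t-1}-\underline r)^+ & \text{if } S_t(\hat{\mathbf d}_t)<(g_{t-1}-\underline r)^+,\\ g_{t-1}+\overline r & \text{if } S_t(\hat{\mathbf d}_t)>g_{t-1}+\overline r,\end{cases}$$ is an optimal policy for the dispatch problem, i.e. it attains the minimum of $\mathbb E\big[\sum_{t=0}^{T-1}(c\,g_t+\psi(d_t,g_t))\big]$ over all causal policies satisfying the ramping and nonnegativity constraints $g_t\in\mathcal G(g_{t-1})$ for all $t$.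
   Context: Notation: $x^+=\max(x,0)$. Data: an integer horizon $T\ge 1$, a unit generation cost $c>0$, maximal ramp-down and ramp-up rates $\underline r>0$, $\overline r>0$, an initial generation level $g_{-1}\ge 0$, and an initial forecast vector $\hat{\mathbf d}_0\in\mathbb R^{T+1}$ (coordinates indexed $0,\dots,T$). Forecast dynamics: $\hat{\mathbf d}_t\in\mathbb R^{T+1}$ is the forecast vector available at time $t$; its coordinate $\hat{\mathbf d}_{t,s}$ equals the realized net demand $d_s$ if $s\le t$ and the forecast of $d_s$ made at time $t$ if $s>t$. It evolves by $\hat{\mathbf d}_{t+1}=\hat{\mathbf d}_t+\mathbf C_t\mathbf e_t$, $t=0,\dots,T-1$, where $\mathbf C_t=\begin{bmatrix}\mathbf 0_{(t+1)\times(T-t)}\\ \mathbf I_{(T-t)\times(T-t)}\end{bmatrix}$ and $\mathbf e_t\in\mathbb R^{T-t}$ are zero-mean Gaussian random vectors with prescribed covariances $\Sigma_t$, independent across $t$. In particular $d_t=\hat{\mathbf d}_{t,t}$ is observed before $g_t$ is chosen. Feasible set: $\mathcal G(g)=\{g'\ge 0:\ -\underline r\le g'-g\le\overline r\}$. Dispatch problem: minimize $\mathbb E\big[\sum_{t=0}^{T-1}(c\,g_t+\psi(d_t,g_t))\big]$ over causal policies $g_t=f_t(\hat{\mathbf d}_0,\dots,\hat{\mathbf d}_t,g_0,\dots,g_{t-1})$ (measurable functions) with $g_t\in\mathcal G(g_{t-1})$ for $t=0,\dots,T-1$. Here $\psi:\mathbb R\times\mathbb R\to(-\infty,+\infty]$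 is a measurable risk penalty, convex in its second argument. Dynamic programming functions: $J_T(\hat{\mathbf d}_T,g_{T-1})=0$ and, for $t=T-1,\dots,0$, $$Q_t(\hat{\mathbf d}_t,g_t)=c\,g_t+\psi(\hat{\mathbf d}_{t,t},g_t)+\mathbb E\big[J_{t+1}(\hat{\mathbf d}_t+\mathbf C_t\mathbf e_t,g_t)\big],\qquad J_t(\hat{\mathbf d}_t,g_{t-1})=\min_{g_t\in\mathcal G(g_{t-1})}Q_t(\hat{\mathbf d}_t,g_t),$$ where in $Q_t$ the expectation is over $\mathbf e_t$ with $\hat{\mathbf d}_t$ and $g_t$ fixed, and a minimum over an empty set is $+\infty$. Standing conventions: the unconstrained minimizers $S_t(\hat{\mathbf d}_t)$ exist and are chosen measurably in $\hat{\mathbf d}_t$; all expectations, including those of the individual stage costs under every causal feasible policy, are well defined with values in $(-\infty,+\infty]$. *)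

theory Defs
  imports "HOL-Probability.Probability"
begin

section \<open>Vectors, Gaussian vectors, extended-real expectations\<close>

text \<open>Vectors in $R^n$ with coordinates \<open>0, \<dots>, n - 1\<close> are extensional functions on \<open>{..<n}\<close>.\<close>

abbreviation vec_space :: "nat \<Rightarrow> (nat \<Rightarrow> real) measure" where
  "vec_space n \<equiv> PiM {..<n} (\<lambda>_. borel)"

text \<open>Point masses count as Gaussian, so that singular covariance matrices are allowed.\<close>

definition gaussian_rv :: "'w measure \<Rightarrow> ('w \<Rightarrow> real) \<Rightarrow> bool" where
  "gaussian_rv M X \<longleftrightarrow>
     (\<exists>\<mu>. AE \<omega> in M. X \<omega> = \<mu>) \<or>
     (\<exists>\<mu> \<sigma>. 0 < \<sigma> \<and> distributed M lborel X (\<lambda>x. ennreal (normal_density \<mu> \<sigma> x)))"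

text \<open>Gaussian vectors are defined through their linear combinations. As the mean is zero,
  the covariance of two coordinates is the expectation of their product.\<close>

definition zero_mean_gaussian_vector ::
  "'w measure \<Rightarrow> nat \<Rightarrow> (nat \<Rightarrow> nat \<Rightarrow> real) \<Rightarrow> ('w \<Rightarrow> nat \<Rightarrow> real) \<Rightarrow> bool" where
  "zero_mean_gaussian_vector M n \<Sigma> X \<longleftrightarrow>
     X \<in> measurable M (vec_space n) \<and>
     (\<forall>a :: nat \<Rightarrow> real. gaussian_rv M (\<lambda>\<omega>. \<Sum>i<n. a i * X \<omega> i)) \<and>
     (\<forall>i<n. integral\<^sup>L M (\<lambda>\<omega>. X \<omega> i) = 0) \<and>
     (\<forall>i<n. \<forall>j<n. integral\<^sup>L M (\<lambda>\<omega>. X \<omega> i * X \<omega> j) = \<Sigma> i j)"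

text \<open>\<open>e2ennreal x\<close> is the positive part of \<open>x\<close>.\<close>

definition ext_expectation :: "'w measure \<Rightarrow> ('w \<Rightarrow> ereal) \<Rightarrow> ereal" where
  "ext_expectation M X =
     enn2ereal (\<integral>\<^sup>+ \<omega>. e2ennreal (X \<omega>) \<partial>M) - enn2ereal (\<integral>\<^sup>+ \<omega>. e2ennreal (- X \<omega>) \<partial>M)"

text \<open>The expectation of \<open>X\<close> is well defined with a value in $(-\infty, +\infty]$.\<close>

definition has_ext_expectation :: "'w measure \<Rightarrow> ('w \<Rightarrow> ereal) \<Rightarrow> bool" where
  "has_ext_expectation M X \<longleftrightarrow>
     X \<in> borel_measurable M \<and> (\<integral>\<^sup>+ \<omega>. e2ennreal (- X \<omega>) \<partial>M) < \<infinity>"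

text \<open>In \<open>ereal\<close>, \<open>0 * \<infinity> = 0\<close>, so the cases \<open>u = 0\<close> and \<open>u = 1\<close> are harmless.\<close>

definition ext_convex :: "(real \<Rightarrow> ereal) \<Rightarrow> bool" where
  "ext_convex f \<longleftrightarrow>
     (\<forall>x y u. 0 \<le> u \<and> u \<le> 1 \<longrightarrow>
        f ((1 - u) * x + u * y) \<le> ereal (1 - u) * f x + ereal u * f y)"


section \<open>Forecast dynamics\<close>

definition C_mat :: "nat \<Rightarrow> nat \<Rightarrow> nat \<Rightarrow> real" where
  "C_mat t s j = (if s = t + 1 + j then 1 else 0)"

definition forecast_step :: "nat \<Rightarrow> nat \<Rightarrow> (nat \<Rightarrow> real) \<Rightarrow> (nat \<Rightarrow> real) \<Rightarrow> nat \<Rightarrow> real" where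
  "forecast_step T t d x = (\<lambda>s\<in>{..<T + 1}. d s + (\<Sum>j<T - t. C_mat t s j * x j))"

primrec forecast ::
  "nat \<Rightarrow> (nat \<Rightarrow> real) \<Rightarrow> (nat \<Rightarrow> 'w \<Rightarrow> nat \<Rightarrow> real) \<Rightarrow> 'w \<Rightarrow> nat \<Rightarrow> nat \<Rightarrow> real" where
  "forecast T d0 e \<omega> 0 = d0"
| "forecast T d0 e \<omega> (Suc t) = forecast_step T t (forecast T d0 e \<omega> t) (e t \<omega>)"


section \<open>Causal policies\<close>

definition feasible_set :: "real \<Rightarrow> real \<Rightarrow> real \<Rightarrow> real set" where
  "feasible_set rdown rup g = {g'. 0 \<le> g' \<and> - rdown \<le> g' - g \<and> g' - g \<le> rup}"

text \<open>A policy \<open>f\<close> maps the stage \<open>t\<close>, the forecasts at times \<open>0, \<dots>, t\<close> and the actions at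
  times \<open>0, \<dots>, t - 1\<close> to the action at time \<open>t\<close>. The argument \<open>D\<close> of \<open>action\<close> is a whole
  forecast path, of which \<open>f t\<close> only sees the part up to time \<open>t\<close>.\<close>

type_synonym policy = "nat \<Rightarrow> (nat \<Rightarrow> nat \<Rightarrow> real) \<Rightarrow> (nat \<Rightarrow> real) \<Rightarrow> real"

fun action :: "policy \<Rightarrow> (nat \<Rightarrow> nat \<Rightarrow> real) \<Rightarrow> nat \<Rightarrow> real" where
  "action f D t = f t (restrict D {..t}) (\<lambda>s. if s < t then action f D s else undefined)"

declare action.simps [simp del]

definition previous :: "real \<Rightarrow> (nat \<Rightarrow> real) \<Rightarrow> nat \<Rightarrow> real" where
  "previous ginit a t = (if t = 0 then ginit else a (t - 1))"

definition causal_policy :: "nat \<Rightarrow> policy \<Rightarrow> bool" where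
  "causal_policy T f \<longleftrightarrow>
     (\<forall>t<T. (\<lambda>(D, a). f t D a) \<in>
        borel_measurable (PiM {..t} (\<lambda>_. vec_space (T + 1)) \<Otimes>\<^sub>M vec_space t))"

definition feasible_policy ::
  "nat \<Rightarrow> real \<Rightarrow> real \<Rightarrow> real \<Rightarrow> (nat \<Rightarrow> real) \<Rightarrow> 'w measure \<Rightarrow>
   (nat \<Rightarrow> 'w \<Rightarrow> nat \<Rightarrow> real) \<Rightarrow> policy \<Rightarrow> bool" where
  "feasible_policy T rdown rup ginit d0 M e f \<longleftrightarrow>
     causal_policy T f \<and>
     (\<forall>\<omega>\<in>space M. \<forall>t<T.
        let g = action f (forecast T d0 e \<omega>)
        in g t \<in> feasible_set rdown rup (previous ginit g t))"

definition stage_cost ::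
  "nat \<Rightarrow> real \<Rightarrow> (real \<Rightarrow> real \<Rightarrow> ereal) \<Rightarrow> (nat \<Rightarrow> real) \<Rightarrow>
   (nat \<Rightarrow> 'w \<Rightarrow> nat \<Rightarrow> real) \<Rightarrow> policy \<Rightarrow> nat \<Rightarrow> 'w \<Rightarrow> ereal" where
  "stage_cost T c \<psi> d0 e f t \<omega> =
     (let D = forecast T d0 e \<omega>; g = action f D t
      in ereal (c * g) + \<psi> (D t t) g)"

definition expected_cost ::
  "nat \<Rightarrow> real \<Rightarrow> (real \<Rightarrow> real \<Rightarrow> ereal) \<Rightarrow> (nat \<Rightarrow> real) \<Rightarrow> 'w measure \<Rightarrow>
   (nat \<Rightarrow> 'w \<Rightarrow> nat \<Rightarrow> real) \<Rightarrow> policy \<Rightarrow> ereal" where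
  "expected_cost T c \<psi> d0 M e f = ext_expectation M (\<lambda>\<omega>. \<Sum>t<T. stage_cost T c \<psi> d0 e f t \<omega>)"

definition optimal_policy ::
  "nat \<Rightarrow> real \<Rightarrow> real \<Rightarrow> real \<Rightarrow> real \<Rightarrow> (real \<Rightarrow> real \<Rightarrow> ereal) \<Rightarrow> (nat \<Rightarrow> real) \<Rightarrow>
   'w measure \<Rightarrow> (nat \<Rightarrow> 'w \<Rightarrow> nat \<Rightarrow> real) \<Rightarrow> policy \<Rightarrow> bool" where
  "optimal_policy T c rdown rup ginit \<psi> d0 M e f \<longleftrightarrow>
     feasible_policy T rdown rup ginit d0 M e f \<and>
     (\<forall>f'. feasible_policy T rdown rup ginit d0 M e f' \<longrightarrow>
        expected_cost T c \<psi> d0 M e f \<le> expected_cost T c \<psi> d0 M e f')"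


section \<open>Dynamic programming functions\<close>

text \<open>\<open>q_step\<close> forms the state-action function at stage \<open>t\<close> from the cost-to-go \<open>V\<close> of stage
  \<open>t + 1\<close>. In \<open>dp_J\<close> an infimum over the empty set is \<open>\<infinity>\<close>.\<close>

definition q_step ::
  "nat \<Rightarrow> real \<Rightarrow> (real \<Rightarrow> real \<Rightarrow> ereal) \<Rightarrow> 'w measure \<Rightarrow> (nat \<Rightarrow> 'w \<Rightarrow> nat \<Rightarrow> real) \<Rightarrow> nat \<Rightarrow>
   ((nat \<Rightarrow> real) \<Rightarrow> real \<Rightarrow> ereal) \<Rightarrow> (nat \<Rightarrow> real) \<Rightarrow> real \<Rightarrow> ereal" where
  "q_step T c \<psi> M e t V d g =
     ereal (c * g) + \<psi> (d t) g + ext_expectation M (\<lambda>\<omega>. V (forecast_step T t d (e t \<omega>)) g)"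

function dp_J ::
  "nat \<Rightarrow> real \<Rightarrow> real \<Rightarrow> real \<Rightarrow> (real \<Rightarrow> real \<Rightarrow> ereal) \<Rightarrow> 'w measure \<Rightarrow>
   (nat \<Rightarrow> 'w \<Rightarrow> nat \<Rightarrow> real) \<Rightarrow> nat \<Rightarrow> (nat \<Rightarrow> real) \<Rightarrow> real \<Rightarrow> ereal" where
  "dp_J T c rdown rup \<psi> M e t =
     (if t < T
      then (\<lambda>d g. INF g'\<in>feasible_set rdown rup g.
              q_step T c \<psi> M e t (dp_J T c rdown rup \<psi> M e (Suc t)) d g')
      else (\<lambda>d g. 0))"
  by pat_completeness auto
termination
  by (relation "Wellfounded.measure (\<lambda>(T, c, rdown, rup, \<psi>, M, e, t). T - t)") auto

declare dp_J.simps [simp del]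

definition dp_Q ::
  "nat \<Rightarrow> real \<Rightarrow> real \<Rightarrow> real \<Rightarrow> (real \<Rightarrow> real \<Rightarrow> ereal) \<Rightarrow> 'w measure \<Rightarrow>
   (nat \<Rightarrow> 'w \<Rightarrow> nat \<Rightarrow> real) \<Rightarrow> nat \<Rightarrow> (nat \<Rightarrow> real) \<Rightarrow> real \<Rightarrow> ereal" where
  "dp_Q T c rdown rup \<psi> M e t = q_step T c \<psi> M e t (dp_J T c rdown rup \<psi> M e (Suc t))"


section \<open>The threshold policy\<close>

definition threshold_rule ::
  "real \<Rightarrow> real \<Rightarrow> (nat \<Rightarrow> (nat \<Rightarrow> real) \<Rightarrow> real) \<Rightarrow> nat \<Rightarrow> (nat \<Rightarrow> real) \<Rightarrow> real \<Rightarrow> real" where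
  "threshold_rule rdown rup S t d g =
     (if max (g - rdown) 0 \<le> S t d \<and> S t d \<le> g + rup then S t d
      else if S t d < max (g - rdown) 0 then max (g - rdown) 0
      else g + rup)"

definition threshold_policy ::
  "real \<Rightarrow> real \<Rightarrow> real \<Rightarrow> (nat \<Rightarrow> (nat \<Rightarrow> real) \<Rightarrow> real) \<Rightarrow> policy" where
  "threshold_policy rdown rup ginit S t D a =
     threshold_rule rdown rup S t (D t) (previous ginit a t)"

end

theory Submission
  imports Defs
begin

text \<open>Backward induction shows that every \<open>dp_J t d\<close> and \<open>dp_Q t d\<close> is convex in the generation
  level and jointly measurable, and that the threshold, being the projection of the unconstrained
  minimizer to the feasible interval, minimizes \<open>dp_Q t d\<close> over this interval. As the noise at
  time \<open>t\<close> is independent of the forecast and of the action at time \<open>t\<close>, Fubini's theorem turns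
  the pointwise inequality $J_t \le Q_t$ along an arbitrary feasible policy into
  $E J_t \le E\,\mathrm{cost}_t + E J_{t+1}$, with equality for the threshold policy. Summing
  over \<open>t\<close> compares both expected costs with the constant $J_0$.\<close>

section \<open>Extended-real expectations\<close>

text \<open>Any splitting \<open>P - N\<close> with integrable \<open>N\<close> gives the
  expectation, not only the splitting into positive and negative part. Pointwise X^+ + N = X^- + P,
  an identity between nonnegative quantities; integrate it and cancel the finite integrals. Later
  computations with expectations then reduce to choosing \<open>P\<close> and
  \<open>N\<close>.\<close>

lemma ext_expectation_diff:
  assumes [measurable]: "X \<in> borel_measurable M" "P \<in> borel_measurable M" "N \<in> borel_measurable M"
    and fin: "(\<integral>\<^sup>+ \<omega>. N \<omega> \<partial>M) < \<infinity>"
    and eq: "AE \<omega> in M. X \<omega> = enn2ereal (P \<omega>) - enn2ereal (N \<omega>)"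
  shows has_ext_expectation_diff: "has_ext_expectation M X"
    and "ext_expectation M X = enn2ereal (\<integral>\<^sup>+ \<omega>. P \<omega> \<partial>M) - enn2ereal (\<integral>\<^sup>+ \<omega>. N \<omega> \<partial>M)"
proof -
  have AE_fin: "AE \<omega> in M. N \<omega> \<noteq> \<infinity>"
    using fin by (intro nn_integral_PInf_AE) auto
  have parts: "e2ennreal (- x) \<le> n" "e2ennreal x + n = e2ennreal (- x) + p"
    if x: "x = enn2ereal p - enn2ereal n" and n: "n \<noteq> \<infinity>" for x p n
  proof -
    obtain b where b: "0 \<le> b" "n = ennreal b"
      using n by (cases n rule: ennreal_cases) auto
    show "e2ennreal (- x) \<le> n"
      using x b
      by (cases p rule: ennreal_cases) (auto intro: ennreal_leI simp: e2ennreal_neg)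
    show "e2ennreal x + n = e2ennreal (- x) + p"
    proof (cases p rule: ennreal_cases)
      case (real a)
      with x b show ?thesis
        by (cases "a \<le> b") (simp_all add: ennreal_neg flip: ennreal_plus)
    qed (use x b in \<open>auto simp: e2ennreal_neg\<close>)
  qed
  have "(\<integral>\<^sup>+ \<omega>. e2ennreal (- X \<omega>) \<partial>M) \<le> (\<integral>\<^sup>+ \<omega>. N \<omega> \<partial>M)"
    using AE_fin eq by (intro nn_integral_mono_AE; eventually_elim) (rule parts)
  then have neg: "(\<integral>\<^sup>+ \<omega>. e2ennreal (- X \<omega>) \<partial>M) < \<infinity>"
    using fin by (rule le_less_trans)
  then show "has_ext_expectation M X"
    by (simp add: has_ext_expectation_def)
  have "(\<integral>\<^sup>+ \<omega>. e2ennreal (X \<omega>) + N \<omega> \<partial>M) = (\<integral>\<^sup>+ \<omega>. e2ennreal (- X \<omega>) + P \<omega> \<partial>M)"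
    using AE_fin eq by (intro nn_integral_cong_AE; eventually_elim) (rule parts)
  then have "(\<integral>\<^sup>+ \<omega>. e2ennreal (X \<omega>) \<partial>M) + (\<integral>\<^sup>+ \<omega>. N \<omega> \<partial>M) =
      (\<integral>\<^sup>+ \<omega>. e2ennreal (- X \<omega>) \<partial>M) + (\<integral>\<^sup>+ \<omega>. P \<omega> \<partial>M)"
    by (simp add: nn_integral_add)
  moreover have "enn2ereal a - enn2ereal b = enn2ereal p - enn2ereal n"
    if "a + n = b + p" "b < \<infinity>" "n < \<infinity>" for a b n p
    using that
    by (cases a rule: ennreal_cases; cases b rule: ennreal_cases;
        cases n rule: ennreal_cases; cases p rule: ennreal_cases)
      (simp_all flip: ennreal_plus)
  ultimately show "ext_expectation M X =
      enn2ereal (\<integral>\<^sup>+ \<omega>. P \<omega> \<partial>M) - enn2ereal (\<integral>\<^sup>+ \<omega>. N \<omega> \<partial>M)"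
    unfolding ext_expectation_def using neg fin by blast
qed

lemma has_ext_expectationD:
  assumes "has_ext_expectation M X"
  shows "X \<in> borel_measurable M" "(\<integral>\<^sup>+ \<omega>. e2ennreal (- X \<omega>) \<partial>M) < \<infinity>"
    "AE \<omega> in M. X \<omega> \<noteq> - \<infinity>"
proof -
  show m[measurable]: "X \<in> borel_measurable M" and f: "(\<integral>\<^sup>+ \<omega>. e2ennreal (- X \<omega>) \<partial>M) < \<infinity>"
    using assms by (auto simp: has_ext_expectation_def)
  have "AE \<omega> in M. e2ennreal (- X \<omega>) \<noteq> \<infinity>"
    using f by (intro nn_integral_PInf_AE) auto
  then show "AE \<omega> in M. X \<omega> \<noteq> - \<infinity>"
    by eventually_elim auto
qed

lemma ext_expectation_gt_minf: "has_ext_expectation M X \<Longrightarrow> - \<infinity> < ext_expectation M X"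
  by (cases "\<integral>\<^sup>+ \<omega>. e2ennreal (X \<omega>) \<partial>M" rule: ennreal_cases;
      cases "\<integral>\<^sup>+ \<omega>. e2ennreal (- X \<omega>) \<partial>M" rule: ennreal_cases)
    (simp_all add: has_ext_expectation_def ext_expectation_def)

lemma ext_expectation_mono:
  assumes "has_ext_expectation M X" "has_ext_expectation M Y"
    and "\<And>\<omega>. \<omega> \<in> space M \<Longrightarrow> X \<omega> \<le> Y \<omega>"
  shows "ext_expectation M X \<le> ext_expectation M Y"
  unfolding ext_expectation_def using assms
  by (intro ereal_minus_mono) (auto intro!: nn_integral_mono e2ennreal_mono simp: less_eq_ennreal.rep_eq[symmetric])

lemma ext_expectation_cong:
  assumes "\<And>\<omega>. \<omega> \<in> space M \<Longrightarrow> X \<omega> = Y \<omega>"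
  shows "ext_expectation M X = ext_expectation M Y"
    "has_ext_expectation M X = has_ext_expectation M Y"
  using assms by (simp_all add: ext_expectation_def has_ext_expectation_def cong: nn_integral_cong measurable_cong)

text \<open>Split with X^+ + Y^+ and X^- + Y^-; the value -\<infinity> occurs only on a null
  set.\<close>

lemma ext_expectation_add:
  assumes "has_ext_expectation M X" "has_ext_expectation M Y"
  shows has_ext_expectation_add: "has_ext_expectation M (\<lambda>\<omega>. X \<omega> + Y \<omega>)"
    and "ext_expectation M (\<lambda>\<omega>. X \<omega> + Y \<omega>) = ext_expectation M X + ext_expectation M Y"
proof -
  note X = has_ext_expectationD[OF assms(1)] and Y = has_ext_expectationD[OF assms(2)]
  note [measurable] = X(1) Y(1)
  have pw: "x + y = enn2ereal (e2ennreal x + e2ennreal y) -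
      enn2ereal (e2ennreal (- x) + e2ennreal (- y))"
    if "x \<noteq> - \<infinity>" "y \<noteq> - \<infinity>" for x y :: ereal
    using that
    by (cases x; cases y)
      (auto simp: plus_ennreal.rep_eq e2ennreal_neg ennreal.rep_eq max_def)
  have eq: "AE \<omega> in M. X \<omega> + Y \<omega> = enn2ereal (e2ennreal (X \<omega>) + e2ennreal (Y \<omega>)) -
      enn2ereal (e2ennreal (- X \<omega>) + e2ennreal (- Y \<omega>))"
    using X(3) Y(3) by eventually_elim (rule pw)
  have fin: "(\<integral>\<^sup>+ \<omega>. e2ennreal (- X \<omega>) + e2ennreal (- Y \<omega>) \<partial>M) < \<infinity>"
    using X(2) Y(2) by (simp add: nn_integral_add)
  note d = ext_expectation_diff[OF _ _ _ fin eq]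
  show "has_ext_expectation M (\<lambda>\<omega>. X \<omega> + Y \<omega>)"
    by (rule d) measurable
  have "ext_expectation M (\<lambda>\<omega>. X \<omega> + Y \<omega>) =
      enn2ereal (\<integral>\<^sup>+ \<omega>. e2ennreal (X \<omega>) + e2ennreal (Y \<omega>) \<partial>M) -
      enn2ereal (\<integral>\<^sup>+ \<omega>. e2ennreal (- X \<omega>) + e2ennreal (- Y \<omega>) \<partial>M)"
    by (rule d) measurable
  also have "\<dots> = ext_expectation M X + ext_expectation M Y"
  proof -
    have "enn2ereal (a + b) - enn2ereal (n + m) = enn2ereal a - enn2ereal n + (enn2ereal b - enn2ereal m)"
      if "n < \<infinity>" "m < \<infinity>" for a b n m
      using that by (cases a rule: ennreal_cases; cases b rule: ennreal_cases;
          cases n rule: ennreal_cases; cases m rule: ennreal_cases) (simp_all add: plus_ennreal.rep_eq)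
    then show ?thesis
      using X(2) Y(2) by (simp add: nn_integral_add ext_expectation_def)
  qed
  finally show "ext_expectation M (\<lambda>\<omega>. X \<omega> + Y \<omega>) = ext_expectation M X + ext_expectation M Y" .
qed

lemma ext_expectation_zero:
  shows has_ext_expectation_zero: "has_ext_expectation M (\<lambda>_. 0)"
    and "ext_expectation M (\<lambda>_. 0) = 0"
  by (simp_all add: has_ext_expectation_def ext_expectation_def zero_ennreal.rep_eq)

lemma ext_expectation_sum:
  assumes "\<And>i. i \<in> I \<Longrightarrow> has_ext_expectation M (X i)"
  shows has_ext_expectation_sum: "has_ext_expectation M (\<lambda>\<omega>. \<Sum>i\<in>I. X i \<omega>)"
    and "ext_expectation M (\<lambda>\<omega>. \<Sum>i\<in>I. X i \<omega>) = (\<Sum>i\<in>I. ext_expectation M (X i))"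
  using assms
  by (induction I rule: infinite_finite_induct)
    (simp_all add: ext_expectation_zero ext_expectation_add)

lemma ext_expectation_cmult:
  assumes "0 \<le> u" "has_ext_expectation M X"
  shows has_ext_expectation_cmult: "has_ext_expectation M (\<lambda>\<omega>. ereal u * X \<omega>)"
    and "ext_expectation M (\<lambda>\<omega>. ereal u * X \<omega>) = ereal u * ext_expectation M X"
proof -
  note X = has_ext_expectationD[OF assms(2)]
  note [measurable] = X(1)
  have pw: "ereal u * x = enn2ereal (ennreal u * e2ennreal x) - enn2ereal (ennreal u * e2ennreal (- x))"
    for x
  proof (cases "u = 0")
    case False
    with assms(1) have "0 < u" by simp
    then show ?thesis
      by (cases x) (auto simp: times_ennreal.rep_eq e2ennreal_neg ennreal.rep_eq max_def mult_le_0_iff zero_ennreal.rep_eq)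
  qed (simp add: zero_ennreal.rep_eq)
  have fin: "(\<integral>\<^sup>+ \<omega>. ennreal u * e2ennreal (- X \<omega>) \<partial>M) < \<infinity>"
    using X(2) by (simp add: nn_integral_cmult ennreal_mult_less_top)
  note d = ext_expectation_diff[OF _ _ _ fin AE_I2[OF pw]]
  show "has_ext_expectation M (\<lambda>\<omega>. ereal u * X \<omega>)"
    by (rule d) measurable
  have "ext_expectation M (\<lambda>\<omega>. ereal u * X \<omega>) =
      enn2ereal (\<integral>\<^sup>+ \<omega>. ennreal u * e2ennreal (X \<omega>) \<partial>M) -
      enn2ereal (\<integral>\<^sup>+ \<omega>. ennreal u * e2ennreal (- X \<omega>) \<partial>M)"
    by (rule d) measurable
  also have "\<dots> = ereal u * ext_expectation M X"
  proof -
    have "enn2ereal (ennreal u * a) - enn2ereal (ennreal u * n) = ereal u * (enn2ereal a - enn2ereal n)"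
      if "n < \<infinity>" for a n
      using that assms(1)
      by (cases a rule: ennreal_cases; cases n rule: ennreal_cases; cases "u = 0")
        (simp_all add: times_ennreal.rep_eq right_diff_distrib zero_ennreal.rep_eq)
    then show ?thesis
      using X(2) by (simp add: nn_integral_cmult ext_expectation_def)
  qed
  finally show "ext_expectation M (\<lambda>\<omega>. ereal u * X \<omega>) = ereal u * ext_expectation M X" .
qed

text \<open>Independence turns the joint law into the product of the laws, where Tonelli's theorem
  applies. Pulling the laws back to \<open>M\<close> makes \<omega>' an independent copy of the
  sample point.\<close>

lemma (in prob_space) nn_integral_indep_var:
  assumes ind: "indep_var A X B Y" and h[measurable]: "h \<in> borel_measurable (A \<Otimes>\<^sub>M B)"
  shows "(\<integral>\<^sup>+ \<omega>. h (X \<omega>, Y \<omega>) \<partial>M) = (\<integral>\<^sup>+ \<omega>. \<integral>\<^sup>+ \<omega>'. h (X \<omega>, Y \<omega>') \<partial>M \<partial>M)"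
proof -
  have [measurable]: "X \<in> measurable M A" "Y \<in> measurable M B"
    using ind by (auto simp: indep_var_rv1 indep_var_rv2)
  interpret Y: prob_space "distr M B Y"
    by (rule prob_space_distr) simp
  have "(\<integral>\<^sup>+ \<omega>. h (X \<omega>, Y \<omega>) \<partial>M) = (\<integral>\<^sup>+ z. h z \<partial>distr M (A \<Otimes>\<^sub>M B) (\<lambda>\<omega>. (X \<omega>, Y \<omega>)))"
    by (simp add: nn_integral_distr)
  also have "\<dots> = (\<integral>\<^sup>+ z. h z \<partial>(distr M A X \<Otimes>\<^sub>M distr M B Y))"
    using ind by (simp add: indep_var_distribution_eq)
  also have "\<dots> = (\<integral>\<^sup>+ x. \<integral>\<^sup>+ y. h (x, y) \<partial>distr M B Y \<partial>distr M A X)"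
    by (subst Y.nn_integral_fst[symmetric]) auto
  also have "\<dots> = (\<integral>\<^sup>+ \<omega>. \<integral>\<^sup>+ y. h (X \<omega>, y) \<partial>distr M B Y \<partial>M)"
    by (subst nn_integral_distr) auto
  also have "\<dots> = (\<integral>\<^sup>+ \<omega>. \<integral>\<^sup>+ \<omega>'. h (X \<omega>, Y \<omega>') \<partial>M \<partial>M)"
    by (intro nn_integral_cong, subst nn_integral_distr) (auto dest: measurable_space[of X M A])
  finally show ?thesis .
qed

text \<open>Fubini's theorem with the value +\<infinity> allowed: Tonelli is used for the positive
  and the negative part separately. The inner integrals need not be the positive and negative part
  of the inner expectation, but their difference equals it, which is all that
  \<open>ext_expectation_diff\<close> asks for.\<close>

lemma (in prob_space) ext_expectation_indep_var:
  assumes ind: "indep_var A X B Y" and h[measurable]: "h \<in> borel_measurable (A \<Otimes>\<^sub>M B)"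
    and ext: "has_ext_expectation M (\<lambda>\<omega>. h (X \<omega>, Y \<omega>))"
  shows has_ext_expectation_indep_var:
      "has_ext_expectation M (\<lambda>\<omega>. ext_expectation M (\<lambda>\<omega>'. h (X \<omega>, Y \<omega>')))"
    and "ext_expectation M (\<lambda>\<omega>. ext_expectation M (\<lambda>\<omega>'. h (X \<omega>, Y \<omega>'))) =
      ext_expectation M (\<lambda>\<omega>. h (X \<omega>, Y \<omega>))"
proof -
  have [measurable]: "X \<in> measurable M A" "Y \<in> measurable M B"
    using ind by (auto simp: indep_var_rv1 indep_var_rv2)
  have eq: "(\<integral>\<^sup>+ \<omega>. e2ennreal (h (X \<omega>, Y \<omega>)) \<partial>M) = (\<integral>\<^sup>+ \<omega>. \<integral>\<^sup>+ \<omega>'. e2ennreal (h (X \<omega>, Y \<omega>')) \<partial>M \<partial>M)"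
    "(\<integral>\<^sup>+ \<omega>. e2ennreal (- h (X \<omega>, Y \<omega>)) \<partial>M) = (\<integral>\<^sup>+ \<omega>. \<integral>\<^sup>+ \<omega>'. e2ennreal (- h (X \<omega>, Y \<omega>')) \<partial>M \<partial>M)"
    using nn_integral_indep_var[OF ind, of "\<lambda>z. e2ennreal (h z)"]
      nn_integral_indep_var[OF ind, of "\<lambda>z. e2ennreal (- h z)"] by simp_all
  have fin: "(\<integral>\<^sup>+ \<omega>. \<integral>\<^sup>+ \<omega>'. e2ennreal (- h (X \<omega>, Y \<omega>')) \<partial>M \<partial>M) < \<infinity>"
    using has_ext_expectationD(2)[OF ext] eq(2) by simp
  have *: "AE \<omega> in M. ext_expectation M (\<lambda>\<omega>'. h (X \<omega>, Y \<omega>')) =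
     enn2ereal (\<integral>\<^sup>+ \<omega>'. e2ennreal (h (X \<omega>, Y \<omega>')) \<partial>M) -
     enn2ereal (\<integral>\<^sup>+ \<omega>'. e2ennreal (- h (X \<omega>, Y \<omega>')) \<partial>M)"
    by (simp add: ext_expectation_def)
  note d = ext_expectation_diff[OF _ _ _ fin *]
  show "has_ext_expectation M (\<lambda>\<omega>. ext_expectation M (\<lambda>\<omega>'. h (X \<omega>, Y \<omega>')))"
    by (rule d) (unfold ext_expectation_def, measurable)
  have "ext_expectation M (\<lambda>\<omega>. ext_expectation M (\<lambda>\<omega>'. h (X \<omega>, Y \<omega>'))) =
     enn2ereal (\<integral>\<^sup>+ \<omega>. \<integral>\<^sup>+ \<omega>'. e2ennreal (h (X \<omega>, Y \<omega>')) \<partial>M \<partial>M) -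
     enn2ereal (\<integral>\<^sup>+ \<omega>. \<integral>\<^sup>+ \<omega>'. e2ennreal (- h (X \<omega>, Y \<omega>')) \<partial>M \<partial>M)"
    by (rule d) (unfold ext_expectation_def, measurable)
  then show "ext_expectation M (\<lambda>\<omega>. ext_expectation M (\<lambda>\<omega>'. h (X \<omega>, Y \<omega>'))) =
      ext_expectation M (\<lambda>\<omega>. h (X \<omega>, Y \<omega>))"
    by (simp add: ext_expectation_def[of M "\<lambda>\<omega>. h (X \<omega>, Y \<omega>)"] eq)
qed

section \<open>Extended-real convex functions\<close>

text \<open>Quasiconvexity. The bound \<open>m\<close> may be infinite, because the distributive law
  of \<open>ereal\<close> used here only asks for nonnegative coefficients.\<close>

lemma ext_convex_bound:
  assumes "ext_convex f" "0 \<le> u" "u \<le> 1" "f x \<le> m" "f y \<le> m"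
  shows "f ((1 - u) * x + u * y) \<le> m"
proof -
  have "f ((1 - u) * x + u * y) \<le> ereal (1 - u) * f x + ereal u * f y"
    using assms by (auto simp: ext_convex_def)
  also have "\<dots> \<le> ereal (1 - u) * m + ereal u * m"
    using assms by (intro add_mono ereal_mult_left_mono) auto
  also have "\<dots> = (ereal (1 - u) + ereal u) * m"
    using assms by (subst ereal_left_distrib) auto
  also have "\<dots> = m"
    by (simp flip: one_ereal_def)
  finally show ?thesis .
qed

text \<open>Both endpoints of the segment have values at most \<open>f x\<close>, so
  \<open>ext_convex_bound\<close> applies with this value as bound. This is why projecting a
  minimizer to an interval is optimal.\<close>

lemma ext_convex_argmin_segment:
  assumes "ext_convex f" "\<And>x. f s \<le> f x" "y \<in> closed_segment s x"
  shows "f y \<le> f x"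
proof -
  obtain u where "0 \<le> u" "u \<le> 1" "y = (1 - u) * s + u * x"
    using assms(3) by (auto simp: in_segment)
  then show ?thesis
    using ext_convex_bound[OF assms(1), of u s "f x" x] assms(2) by auto
qed

lemma ext_convex_add:
  assumes "ext_convex f" "ext_convex h"
  shows "ext_convex (\<lambda>x. f x + h x)"
  unfolding ext_convex_def
proof (intro allI impI)
  fix x y u :: real
  assume u: "0 \<le> u \<and> u \<le> 1"
  have "f ((1 - u) * x + u * y) + h ((1 - u) * x + u * y) \<le>
      (ereal (1 - u) * f x + ereal u * f y) + (ereal (1 - u) * h x + ereal u * h y)"
    using assms u by (intro add_mono) (auto simp: ext_convex_def)
  also have "\<dots> = ereal (1 - u) * (f x + h x) + ereal u * (f y + h y)"
    using u distrib_left_ereal_nn[of u "f y" "h y"] distrib_left_ereal_nn[of "1 - u" "f x" "h x"]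
    by (simp add: ac_simps)
  finally show "f ((1 - u) * x + u * y) + h ((1 - u) * x + u * y) \<le>
      ereal (1 - u) * (f x + h x) + ereal u * (f y + h y)" .
qed

lemma ext_convex_linear: "ext_convex (\<lambda>x. ereal (c * x))"
  by (auto simp: ext_convex_def algebra_simps)

lemma ext_convex_expectation:
  assumes convex: "\<And>\<omega>. \<omega> \<in> space M \<Longrightarrow> ext_convex (f \<omega>)"
    and ext: "\<And>x. has_ext_expectation M (\<lambda>\<omega>. f \<omega> x)"
  shows "ext_convex (\<lambda>x. ext_expectation M (\<lambda>\<omega>. f \<omega> x))"
  unfolding ext_convex_def
proof (intro allI impI)
  fix x y u :: real
  assume u: "0 \<le> u \<and> u \<le> 1"
  note E = ext_expectation_cmult[OF _ ext] ext_expectation_add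
  have "ext_expectation M (\<lambda>\<omega>. f \<omega> ((1 - u) * x + u * y)) \<le>
      ext_expectation M (\<lambda>\<omega>. ereal (1 - u) * f \<omega> x + ereal u * f \<omega> y)"
    using u convex by (intro ext_expectation_mono ext E) (auto simp: ext_convex_def)
  also have "\<dots> = ereal (1 - u) * ext_expectation M (\<lambda>\<omega>. f \<omega> x) + ereal u * ext_expectation M (\<lambda>\<omega>. f \<omega> y)"
    using u by (simp add: E)
  finally show "ext_expectation M (\<lambda>\<omega>. f \<omega> ((1 - u) * x + u * y)) \<le>
      ereal (1 - u) * ext_expectation M (\<lambda>\<omega>. f \<omega> x) + ereal u * ext_expectation M (\<lambda>\<omega>. f \<omega> y)" .
qed

section \<open>Forecasts and actions\<close>

lemma mem_feasible_set:
  "g' \<in> feasible_set rdown rup g \<longleftrightarrow> max (g - rdown) 0 \<le> g' \<and> g' \<le> g + rup"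
  by (auto simp: feasible_set_def)

text \<open>The feasible pairs of old and new levels are cut out by linear inequalities, so they
  form a convex set. Partial minimization over it therefore preserves convexity.\<close>

lemma feasible_set_convex_combination:
  assumes "0 \<le> u" "u \<le> 1" "x' \<in> feasible_set rdown rup x" "y' \<in> feasible_set rdown rup y"
  shows "(1 - u) * x' + u * y' \<in> feasible_set rdown rup ((1 - u) * x + u * y)"
proof -
  have "(1 - u) * (- rdown) \<le> (1 - u) * (x' - x)" "u * (- rdown) \<le> u * (y' - y)"
    "(1 - u) * (x' - x) \<le> (1 - u) * rup" "u * (y' - y) \<le> u * rup"
    using assms by (intro mult_left_mono; simp add: feasible_set_def)+
  moreover have "0 \<le> (1 - u) * x' + u * y'"
    using assms by (simp add: feasible_set_def)
  ultimately show ?thesis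
    unfolding feasible_set_def mem_Collect_eq by (intro conjI) (simp_all add: algebra_simps)
qed

lemma forecast_step_space: "forecast_step T t d x \<in> space (vec_space (T + 1))"
  by (simp add: forecast_step_def space_PiM)

lemma measurable_forecast_step:
  assumes "f \<in> measurable N (vec_space (T + 1))" "h \<in> measurable N (vec_space (T - t))"
  shows "(\<lambda>x. forecast_step T t (f x) (h x)) \<in> measurable N (vec_space (T + 1))"
proof -
  have "(\<lambda>x. f x s) \<in> borel_measurable N" if "s < T + 1" for s
    using that by (intro measurable_compose[OF assms(1)] measurable_component_singleton) auto
  moreover have "(\<lambda>x. h x s) \<in> borel_measurable N" if "s < T - t" for s
    using that by (intro measurable_compose[OF assms(2)] measurable_component_singleton) auto
  ultimately show ?thesis
    unfolding forecast_step_def by (intro measurable_restrict borel_measurable_add borel_measurable_sum borel_measurable_times) auto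
qed

lemma forecast_space:
  assumes "d0 \<in> space (vec_space (T + 1))"
  shows "forecast T d0 E \<omega> t \<in> space (vec_space (T + 1))"
  using assms forecast_step_space by (cases t) auto

text \<open>Nonanticipation: only the noise of indices below \<open>t\<close> enters. The two sample
  points may live in different spaces, so that the forecast can be rebuilt from the noise
  coordinates alone.\<close>

lemma forecast_cong:
  assumes "\<And>i. i < t \<Longrightarrow> E i \<omega> = E' i \<omega>'"
  shows "forecast T d0 E \<omega> t = forecast T d0 E' \<omega>' t"
  using assms by (induction t) auto

lemma forecast_measurable:
  assumes "d0 \<in> space (vec_space (T + 1))"
    and "\<And>i. i < t \<Longrightarrow> E i \<in> measurable N (vec_space (T - i))"
  shows "(\<lambda>\<omega>. forecast T d0 E \<omega> t) \<in> measurable N (vec_space (T + 1))"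
  using assms(2)
proof (induction t)
  case 0
  show ?case using assms(1) by simp
next
  case (Suc t)
  then show ?case
    unfolding forecast.simps by (intro measurable_forecast_step) auto
qed

text \<open>Strong induction, as the action at \<open>t\<close> reads all earlier ones. The policies
  may differ after \<open>t\<close>; this is used to compare a policy with its splice.\<close>

lemma action_cong:
  assumes "\<And>s. s \<le> t \<Longrightarrow> D s = D' s" "\<And>s. s \<le> t \<Longrightarrow> f s = f' s"
  shows "action f D t = action f' D' t"
  using assms
proof (induction t rule: less_induct)
  case (less t)
  have "restrict D {..t} = restrict D' {..t}"
    using less.prems(1) by (intro restrict_ext) auto
  moreover have "(\<lambda>s. if s < t then action f D s else undefined) =
      (\<lambda>s. if s < t then action f' D' s else undefined)"
    using less by (intro ext) auto
  ultimately show ?case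
    using less.prems(2)[of t] by (simp add: action.simps[of _ _ t])
qed

lemma previous_cong:
  assumes "\<And>s. s < t \<Longrightarrow> a s = b s"
  shows "previous ginit a t = previous ginit b t"
  using assms by (simp add: previous_def)

lemma action_measurable:
  assumes causal: "causal_policy T f" and "t < T"
    and D: "\<And>s. s \<le> t \<Longrightarrow> (\<lambda>\<omega>. D \<omega> s) \<in> measurable N (vec_space (T + 1))"
  shows "(\<lambda>\<omega>. action f (D \<omega>) t) \<in> borel_measurable N"
  using assms(2,3)
proof (induction t rule: less_induct)
  case (less t)
  \<comment> \<open>Restriction puts \<open>undefined\<close> at the indices from \<open>t\<close>
    on, as the recursion of \<open>action\<close> does, so this is exactly the pair of arguments
    that \<open>f t\<close> receives.\<close>
  let ?h = "\<lambda>\<omega>. (restrict (D \<omega>) {..t}, \<lambda>s\<in>{..<t}. action f (D \<omega>) s)"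
  have "?h \<in> measurable N (PiM {..t} (\<lambda>_. vec_space (T + 1)) \<Otimes>\<^sub>M vec_space t)"
    using less by (intro measurable_Pair measurable_restrict) auto
  moreover have "(\<lambda>(D, a). f t D a) \<in>
      borel_measurable (PiM {..t} (\<lambda>_. vec_space (T + 1)) \<Otimes>\<^sub>M vec_space t)"
    using causal \<open>t < T\<close> by (auto simp: causal_policy_def)
  ultimately have "(\<lambda>\<omega>. (\<lambda>(D, a). f t D a) (?h \<omega>)) \<in> borel_measurable N"
    by (rule measurable_compose)
  then show ?case
    by (simp add: action.simps[of _ _ t] restrict_def)
qed

section \<open>The dispatch problem\<close>

text \<open>Well-definedness enters twice: \<open>Q_well_defined\<close> at each fixed state serves
  the convexity of the recursion, \<open>stage_costs_well_defined\<close> along policies serves the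
  comparison of expected costs.\<close>

locale ramp_dispatch = prob_space M
  for M :: "'w measure"
    and T :: nat
    and c rdown rup ginit :: real
    and d0 :: "nat \<Rightarrow> real"
    and e :: "nat \<Rightarrow> 'w \<Rightarrow> nat \<Rightarrow> real"
    and \<psi> :: "real \<Rightarrow> real \<Rightarrow> ereal"
    and S :: "nat \<Rightarrow> (nat \<Rightarrow> real) \<Rightarrow> real" +
  assumes ramps_nonneg: "0 \<le> rdown" "0 \<le> rup" and ginit_nonneg: "0 \<le> ginit"
    and d0_space: "d0 \<in> space (vec_space (T + 1))"
    and indep: "indep_vars (\<lambda>t. vec_space (T - t)) e {..<T}"
    and psi_measurable [measurable]: "(\<lambda>(d, g). \<psi> d g) \<in> borel_measurable (borel \<Otimes>\<^sub>M borel)"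
    and psi_proper: "\<And>d g. \<psi> d g > - \<infinity>"
    and psi_convex: "\<And>d. ext_convex (\<psi> d)"
    and Q_well_defined: "\<And>t d g. t < T \<Longrightarrow> d \<in> space (vec_space (T + 1)) \<Longrightarrow>
          has_ext_expectation M
            (\<lambda>\<omega>. dp_J T c rdown rup \<psi> M e (Suc t) (forecast_step T t d (e t \<omega>)) g)"
    and stage_costs_well_defined: "\<And>f t. feasible_policy T rdown rup ginit d0 M e f \<Longrightarrow> t < T \<Longrightarrow>
          has_ext_expectation M (stage_cost T c \<psi> d0 e f t)"
    and S_measurable: "\<And>t. t < T \<Longrightarrow> S t \<in> borel_measurable (vec_space (T + 1))"
    and S_argmin: "\<And>t d. t < T \<Longrightarrow> d \<in> space (vec_space (T + 1)) \<Longrightarrow>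
          is_arg_min (dp_Q T c rdown rup \<psi> M e t d) (\<lambda>g. True) (S t d)"
begin

abbreviation "J \<equiv> dp_J T c rdown rup \<psi> M e"
abbreviation "Q \<equiv> dp_Q T c rdown rup \<psi> M e"
abbreviation "\<mu> \<equiv> threshold_rule rdown rup S"

section \<open>Elementary bounds for the dynamic programming functions\<close>

lemma e_measurable: "t < T \<Longrightarrow> e t \<in> measurable M (vec_space (T - t))"
  using indep by (auto simp: indep_vars_def)

lemma J_terminal: "J T d g = 0"
  by (simp add: dp_J.simps[of T _ _ _ _ _ _ T])

lemma J_eq_INF: "t < T \<Longrightarrow> J t d g = (INF g'\<in>feasible_set rdown rup g. Q t d g')"
  by (simp add: dp_J.simps[of T _ _ _ _ _ _ t] dp_Q_def)

lemma Q_eq: "Q t d g = ereal (c * g) + \<psi> (d t) g +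
    ext_expectation M (\<lambda>\<omega>. J (Suc t) (forecast_step T t d (e t \<omega>)) g)"
  by (simp add: dp_Q_def q_step_def)

lemma Q_gt_minf:
  assumes "t < T" "d \<in> space (vec_space (T + 1))"
  shows "- \<infinity> < Q t d g"
  using ext_expectation_gt_minf[OF Q_well_defined[OF assms, of g]] psi_proper[of "d t" g]
  by (simp add: Q_eq)

lemma Q_S_le:
  assumes "t < T" "d \<in> space (vec_space (T + 1))"
  shows "Q t d (S t d) \<le> Q t d g"
  using S_argmin[OF assms] by (simp add: is_arg_min_def not_less)

text \<open>The unconstrained minimum \<open>Q t d (S t d)\<close> bounds the infimum from below,
  and as an attained value it exceeds -\<infinity>.\<close>

lemma J_gt_minf:
  assumes "t < T" "d \<in> space (vec_space (T + 1))"
  shows "- \<infinity> < J t d g"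
proof -
  have "Q t d (S t d) \<le> J t d g"
    using assms by (auto simp: J_eq_INF intro!: INF_greatest Q_S_le)
  with Q_gt_minf[OF assms, of "S t d"] show ?thesis
    by (rule less_le_trans)
qed

section \<open>The threshold as constrained minimizer\<close>

lemma threshold_feasible:
  assumes "0 \<le> g + rup"
  shows "\<mu> t d g \<in> feasible_set rdown rup g"
  using assms ramps_nonneg by (auto simp: mem_feasible_set threshold_rule_def)

text \<open>Levels below \<open>- rup\<close> have no feasible successor and get cost \<infinity>.
  Feasible policies never reach them, but convexity and measurability of \<open>J\<close> are
  claimed for all real levels.\<close>

lemma feasible_set_nonempty_iff: "feasible_set rdown rup g \<noteq> {} \<longleftrightarrow> 0 \<le> g + rup"
  using threshold_feasible[of g] by (auto simp: feasible_set_def)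

text \<open>The threshold is the projection of the unconstrained minimizer to the feasible interval,
  hence lies on the segment from that minimizer to any feasible action.\<close>

lemma Q_threshold_le:
  assumes "t < T" "d \<in> space (vec_space (T + 1))" "ext_convex (Q t d)"
    and "g' \<in> feasible_set rdown rup g"
  shows "Q t d (\<mu> t d g) \<le> Q t d g'"
proof (rule ext_convex_argmin_segment[OF assms(3) Q_S_le[OF assms(1,2)]])
  show "\<mu> t d g \<in> closed_segment (S t d) g'"
    using assms(4) by (auto simp: mem_feasible_set threshold_rule_def closed_segment_eq_real_ivl)
qed

text \<open>The infimum is attained at the threshold. Both convexity and measurability of
  \<open>J\<close> are derived from this closed form.\<close>

lemma J_eq_Q_threshold:
  assumes "t < T" "d \<in> space (vec_space (T + 1))" "ext_convex (Q t d)" "0 \<le> g + rup"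
  shows "J t d g = Q t d (\<mu> t d g)"
  using Q_threshold_le[OF assms(1-3)] threshold_feasible[OF assms(4)]
  by (auto simp: J_eq_INF[OF assms(1)] intro!: antisym INF_lower INF_greatest)

section \<open>Convexity in the generation level\<close>

text \<open>Partial minimization of a convex function over a convex set of pairs. As the infimum is
  attained, the convex combination of the two thresholds is a competitor, and no approximate
  minimizers appear.\<close>

lemma J_convex_of_Q_convex:
  assumes t: "t < T" and d: "d \<in> space (vec_space (T + 1))" and convex: "ext_convex (Q t d)"
  shows "ext_convex (J t d)"
  unfolding ext_convex_def
proof (intro allI impI)
  fix x y u :: real
  assume u: "0 \<le> u \<and> u \<le> 1"
  have infinite: "J t d g = \<infinity>" if "\<not> 0 \<le> g + rup" for g
    using that feasible_set_nonempty_iff[of g] by (simp add: J_eq_INF[OF t] top_ereal_def)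
  note gt = J_gt_minf[OF t d]
  show "J t d ((1 - u) * x + u * y) \<le> ereal (1 - u) * J t d x + ereal u * J t d y"
  proof (cases "u = 0 \<or> u = 1")
    case True
    then show ?thesis by (auto simp flip: one_ereal_def zero_ereal_def)
  next
    case False
    with u have u': "0 < u" "u < 1" by auto
    show ?thesis
    proof (cases "0 \<le> x + rup \<and> 0 \<le> y + rup")
      case True
      let ?g = "(1 - u) * \<mu> t d x + u * \<mu> t d y"
      have "?g \<in> feasible_set rdown rup ((1 - u) * x + u * y)"
        using True u by (intro feasible_set_convex_combination threshold_feasible) auto
      then have "J t d ((1 - u) * x + u * y) \<le> Q t d ?g"
        by (simp add: J_eq_INF[OF t] INF_lower)
      also have "\<dots> \<le> ereal (1 - u) * Q t d (\<mu> t d x) + ereal u * Q t d (\<mu> t d y)"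
        using convex u by (auto simp: ext_convex_def)
      finally show ?thesis
        using True by (simp add: J_eq_Q_threshold[OF assms])
    next
      case False
      \<comment> \<open>One of the two levels has an empty feasible set, so its value \<infinity>
        carries a positive weight; the other value exceeds -\<infinity>.\<close>
      have "ereal (1 - u) * J t d x + ereal u * J t d y = \<infinity>"
        using False u' infinite gt[of x] gt[of y]
        by (cases "J t d x"; cases "J t d y") auto
      then show ?thesis by (simp only: ereal_less_eq)
    qed
  qed
qed

lemma Q_convex_of_J_convex:
  assumes t: "t < T" and d: "d \<in> space (vec_space (T + 1))"
    and convex: "\<And>d. d \<in> space (vec_space (T + 1)) \<Longrightarrow> ext_convex (J (Suc t) d)"
  shows "ext_convex (Q t d)"
proof -
  \<comment> \<open>For each noise outcome the next forecast is a fixed state, so convexity in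
    \<open>g\<close> passes through the average.\<close>
  have "ext_convex (\<lambda>g. ext_expectation M (\<lambda>\<omega>. J (Suc t) (forecast_step T t d (e t \<omega>)) g))"
    using Q_well_defined[OF t d] convex forecast_step_space by (intro ext_convex_expectation) auto
  from ext_convex_add[OF ext_convex_add[OF ext_convex_linear[of c] psi_convex[of "d t"]] this]
  show ?thesis
    unfolding Q_eq[symmetric] .
qed

lemma J_convex:
  assumes "t \<le> T" "d \<in> space (vec_space (T + 1))"
  shows "ext_convex (J t d)"
  using assms
proof (induction arbitrary: d rule: inc_induct)
  case base
  then show ?case by (simp add: ext_convex_def J_terminal)
next
  case (step t)
  show ?case
    by (rule J_convex_of_Q_convex[OF _ _ Q_convex_of_J_convex]) (use step in auto)
qed

lemma Q_convex:
  assumes "t < T" "d \<in> space (vec_space (T + 1))"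
  shows "ext_convex (Q t d)"
  using assms by (intro Q_convex_of_J_convex J_convex) auto

section \<open>Joint measurability in forecast and level\<close>

text \<open>The composite form serves twice: on the state space for \<open>J\<close>, and on the
  space of histories for causality of the threshold policy.\<close>

lemma threshold_measurable:
  assumes t: "t < T" and f: "f \<in> measurable N (vec_space (T + 1))" and h[measurable]: "h \<in> borel_measurable N"
  shows "(\<lambda>x. \<mu> t (f x) (h x)) \<in> borel_measurable N"
proof -
  define s where "s = (\<lambda>x. S t (f x))"
  have [measurable]: "s \<in> borel_measurable N"
    unfolding s_def using f S_measurable[OF t] by (rule measurable_compose)
  have "(\<lambda>x. if max (h x - rdown) 0 \<le> s x \<and> s x \<le> h x + rup then s x
      else if s x < max (h x - rdown) 0 then max (h x - rdown) 0 else h x + rup) \<in> borel_measurable N"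
    by measurable
  then show ?thesis
    by (simp only: threshold_rule_def s_def)
qed

text \<open>The noise is a separate vector argument, since the Fubini argument needs the integrand
  as a function on the product of state-action pairs and noise vectors.\<close>

lemma J_step_measurable:
  assumes t: "t < T" and J: "(\<lambda>(d, g). J (Suc t) d g) \<in> borel_measurable (vec_space (T + 1) \<Otimes>\<^sub>M borel)"
  shows "(\<lambda>z. J (Suc t) (forecast_step T t (fst (fst z)) (snd z)) (snd (fst z))) \<in>
    borel_measurable ((vec_space (T + 1) \<Otimes>\<^sub>M borel) \<Otimes>\<^sub>M vec_space (T - t))"
proof -
  have "(\<lambda>z. (forecast_step T t (fst (fst z)) (snd z), snd (fst z))) \<in>
      measurable ((vec_space (T + 1) \<Otimes>\<^sub>M borel) \<Otimes>\<^sub>M vec_space (T - t)) (vec_space (T + 1) \<Otimes>\<^sub>M borel)"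
    by (intro measurable_Pair measurable_forecast_step measurable_snd
        measurable_compose[OF measurable_fst measurable_fst] measurable_compose[OF measurable_fst measurable_snd])
  from measurable_compose[OF this J] show ?thesis
    by (simp add: case_prod_beta)
qed

lemma Q_measurable_of_J_measurable:
  assumes t: "t < T" and J: "(\<lambda>(d, g). J (Suc t) d g) \<in> borel_measurable (vec_space (T + 1) \<Otimes>\<^sub>M borel)"
  shows "(\<lambda>(d, g). Q t d g) \<in> borel_measurable (vec_space (T + 1) \<Otimes>\<^sub>M borel)"
proof -
  have [measurable]: "e t \<in> measurable M (vec_space (T - t))"
    by (rule e_measurable[OF t])
  have J': "(\<lambda>z. J (Suc t) (forecast_step T t (fst (fst z)) (e t (snd z))) (snd (fst z))) \<in>
      borel_measurable ((vec_space (T + 1) \<Otimes>\<^sub>M borel) \<Otimes>\<^sub>M M)"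
  proof -
    have "(\<lambda>z. (fst z, e t (snd z))) \<in> measurable ((vec_space (T + 1) \<Otimes>\<^sub>M borel) \<Otimes>\<^sub>M M)
        ((vec_space (T + 1) \<Otimes>\<^sub>M borel) \<Otimes>\<^sub>M vec_space (T - t))"
      by measurable
    from measurable_compose[OF this J_step_measurable[OF assms]] show ?thesis
      by simp
  qed
  have "(\<lambda>z. fst z t) \<in> borel_measurable (vec_space (T + 1) \<Otimes>\<^sub>M borel)"
    using t by (intro measurable_compose[OF measurable_fst measurable_component_singleton]) auto
  then have "(\<lambda>z. (fst z t, snd z)) \<in>
      measurable (vec_space (T + 1) \<Otimes>\<^sub>M borel) (borel \<Otimes>\<^sub>M (borel :: real measure))"
    by (rule measurable_Pair) measurable
  from measurable_compose[OF this psi_measurable]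
  have [measurable]: "(\<lambda>z. \<psi> (fst z t) (snd z)) \<in> borel_measurable (vec_space (T + 1) \<Otimes>\<^sub>M borel)"
    by simp
  \<comment> \<open>By definition this is a difference of two nonnegative integrals, each depending
    measurably on the parameter \<open>z\<close>.\<close>
  have [measurable]: "(\<lambda>z. ext_expectation M (\<lambda>\<omega>. J (Suc t) (forecast_step T t (fst z) (e t \<omega>)) (snd z)))
      \<in> borel_measurable (vec_space (T + 1) \<Otimes>\<^sub>M borel)"
    unfolding ext_expectation_def
    using J' by (intro borel_measurable_ereal_diff measurable_compose[OF _ measurable_enn2ereal]
        borel_measurable_nn_integral) (simp_all add: case_prod_beta)
  show ?thesis
    unfolding Q_eq case_prod_beta by measurable
qed

text \<open>An infimum over uncountably many actions need not be measurable. Here it equals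
  \<open>Q\<close> composed with the measurable threshold where the feasible set is nonempty, and
  \<infinity> elsewhere.\<close>

lemma J_measurable:
  assumes "t \<le> T"
  shows "(\<lambda>(d, g). J t d g) \<in> borel_measurable (vec_space (T + 1) \<Otimes>\<^sub>M borel)"
  using assms
proof (induction rule: inc_induct)
  case base
  then show ?case by (simp add: J_terminal)
next
  case (step t)
  have t: "t < T" by fact
  have "(\<lambda>z. (fst z, \<mu> t (fst z) (snd z))) \<in>
      measurable (vec_space (T + 1) \<Otimes>\<^sub>M borel) (vec_space (T + 1) \<Otimes>\<^sub>M borel)"
    by (intro measurable_Pair threshold_measurable t) auto
  from measurable_compose[OF this Q_measurable_of_J_measurable[OF t step.IH]]
  have [measurable]: "(\<lambda>z. Q t (fst z) (\<mu> t (fst z) (snd z))) \<in> borel_measurable (vec_space (T + 1) \<Otimes>\<^sub>M borel)"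
    by (simp add: case_prod_beta)
  have "(\<lambda>z. if 0 \<le> snd z + rup then Q t (fst z) (\<mu> t (fst z) (snd z)) else \<infinity>) \<in>
      borel_measurable (vec_space (T + 1) \<Otimes>\<^sub>M borel)"
    by measurable
  then show ?case
  proof (rule measurable_cong[THEN iffD1, rotated])
    fix z :: "(nat \<Rightarrow> real) \<times> real"
    assume "z \<in> space (vec_space (T + 1) \<Otimes>\<^sub>M borel)"
    then have d: "fst z \<in> space (vec_space (T + 1))"
      by (auto simp: space_pair_measure)
    show "(if 0 \<le> snd z + rup then Q t (fst z) (\<mu> t (fst z) (snd z)) else \<infinity>) = (case z of (d, g) \<Rightarrow> J t d g)"
      using J_eq_Q_threshold[OF t d Q_convex[OF t d], of "snd z"] feasible_set_nonempty_iff[of "snd z"]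
      by (auto simp: case_prod_beta J_eq_INF[OF t] top_ereal_def)
  qed
qed

section \<open>Policies along the random forecast path\<close>

abbreviation "D \<equiv> forecast T d0 e"
abbreviation "act f \<omega> \<equiv> action f (D \<omega>)"
abbreviation "feasible f \<equiv> feasible_policy T rdown rup ginit d0 M e f"
abbreviation "cost \<equiv> stage_cost T c \<psi> d0 e"

text \<open>The state at time \<open>t\<close> remains that of \<open>f\<close>. With
  \<open>t = 0\<close> this is the threshold policy itself, so statements about splices cover
  it.\<close>

definition splice :: "policy \<Rightarrow> nat \<Rightarrow> policy" where
  "splice f t s = (if s < t then f s else threshold_policy rdown rup ginit S s)"

definition J_along :: "policy \<Rightarrow> nat \<Rightarrow> 'w \<Rightarrow> ereal" where
  "J_along f t \<omega> = J t (D \<omega> t) (previous ginit (act f \<omega>) t)"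

definition Q_along :: "policy \<Rightarrow> nat \<Rightarrow> 'w \<Rightarrow> ereal" where
  "Q_along f t \<omega> = Q t (D \<omega> t) (act f \<omega> t)"

lemma splice_0: "splice f 0 = threshold_policy rdown rup ginit S"
  by (simp add: splice_def fun_eq_iff)

lemma action_splice_before: "s < t \<Longrightarrow> action (splice f t) H s = action f H s"
  by (intro action_cong) (auto simp: splice_def fun_eq_iff)

lemma action_splice_after:
  assumes "t \<le> s"
  shows "action (splice f t) H s = \<mu> s (H s) (previous ginit (action (splice f t) H) s)"
  using assms
  by (subst action.simps) (auto simp: splice_def threshold_policy_def previous_def)

lemma D_space: "D \<omega> t \<in> space (vec_space (T + 1))"
  by (rule forecast_space[OF d0_space])

lemma feasibleD:
  assumes "feasible f" "\<omega> \<in> space M" "t < T"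
  shows "act f \<omega> t \<in> feasible_set rdown rup (previous ginit (act f \<omega>) t)"
  using assms by (auto simp: feasible_policy_def Let_def)

text \<open>Nonnegative levels satisfy \<open>0 \<le> g + rup\<close>, so the next feasible set is
  nonempty.\<close>

lemma previous_nonneg:
  assumes "\<And>s. s < t \<Longrightarrow> a s \<in> feasible_set rdown rup (previous ginit a s)"
  shows "0 \<le> previous ginit a t"
  using assms[of "t - 1"] ginit_nonneg by (auto simp: previous_def feasible_set_def)

lemma threshold_policy_measurable:
  assumes "t < T"
  shows "(\<lambda>(H, a). threshold_policy rdown rup ginit S t H a) \<in>
    borel_measurable (PiM {..t} (\<lambda>_. vec_space (T + 1)) \<Otimes>\<^sub>M vec_space t)"
proof -
  have "(\<lambda>z. fst z t) \<in> measurable (PiM {..t} (\<lambda>_. vec_space (T + 1)) \<Otimes>\<^sub>M vec_space t) (vec_space (T + 1))"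
    by (rule measurable_compose[OF measurable_fst measurable_component_singleton]) simp
  moreover have "(\<lambda>z. previous ginit (snd z) t) \<in>
      borel_measurable (PiM {..t} (\<lambda>_. vec_space (T + 1)) \<Otimes>\<^sub>M vec_space t)"
  proof (cases "t = 0")
    case False
    have "(\<lambda>z. snd z (t - 1)) \<in> borel_measurable (PiM {..t} (\<lambda>_. vec_space (T + 1)) \<Otimes>\<^sub>M vec_space t)"
      using False by (intro measurable_compose[OF measurable_snd measurable_component_singleton]) simp
    with False show ?thesis by (simp add: previous_def)
  qed (simp add: previous_def)
  ultimately show ?thesis
    unfolding threshold_policy_def case_prod_beta by (rule threshold_measurable[OF assms])
qed

text \<open>The hypothesis is conditional so that \<open>t = 0\<close> yields feasibility of the
  threshold policy outright. Strong induction is needed, as nonemptiness of the feasible set at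
  \<open>s\<close> comes from feasibility of the earlier actions.\<close>

lemma splice_feasible:
  assumes f: "0 < t \<Longrightarrow> feasible f"
  shows "feasible (splice f t)"
proof -
  have "causal_policy T (splice f t)"
    unfolding causal_policy_def
  proof (intro allI impI)
    fix s assume "s < T"
    with f show "(\<lambda>(H, a). splice f t s H a) \<in>
        borel_measurable (PiM {..s} (\<lambda>_. vec_space (T + 1)) \<Otimes>\<^sub>M vec_space s)"
      using threshold_policy_measurable[of s]
      by (cases "s < t") (auto simp: splice_def feasible_policy_def causal_policy_def)
  qed
  moreover have "act (splice f t) \<omega> s \<in> feasible_set rdown rup (previous ginit (act (splice f t) \<omega>) s)"
    if \<omega>: "\<omega> \<in> space M" and "s < T" for \<omega> s
    using \<open>s < T\<close>
  proof (induction s rule: less_induct)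
    case (less s)
    show ?case
    proof (cases "s < t")
      case True
      then have "previous ginit (act (splice f t) \<omega>) s = previous ginit (act f \<omega>) s"
        by (intro previous_cong action_splice_before) auto
      with True feasibleD[OF f \<omega> less.prems] show ?thesis
        by (simp add: action_splice_before)
    next
      case False
      have "0 \<le> previous ginit (act (splice f t) \<omega>) s"
        using less by (intro previous_nonneg) auto
      then have "\<mu> s (D \<omega> s) (previous ginit (act (splice f t) \<omega>) s) \<in>
          feasible_set rdown rup (previous ginit (act (splice f t) \<omega>) s)"
        using ramps_nonneg by (intro threshold_feasible) auto
      with False show ?thesis
        by (subst action_splice_after) auto
    qed
  qed
  ultimately show ?thesis
    by (auto simp: feasible_policy_def Let_def)
qed

section \<open>Independence of the current state and the next noise\<close>

text \<open>The forecast and the action at time \<open>t\<close> are functions of the noise of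
  indices below \<open>t\<close>, hence independent of \<open>e t\<close>, and Fubini's theorem
  applies.\<close>

lemma ext_expectation_state_noise:
  assumes causal: "causal_policy T f" and t: "t < T"
    and h: "h \<in> borel_measurable ((vec_space (T + 1) \<Otimes>\<^sub>M borel) \<Otimes>\<^sub>M vec_space (T - t))"
    and ext: "has_ext_expectation M (\<lambda>\<omega>. h ((D \<omega> t, act f \<omega> t), e t \<omega>))"
  shows has_ext_expectation_state_noise:
      "has_ext_expectation M (\<lambda>\<omega>. ext_expectation M (\<lambda>\<omega>'. h ((D \<omega> t, act f \<omega> t), e t \<omega>')))"
    and "ext_expectation M (\<lambda>\<omega>. ext_expectation M (\<lambda>\<omega>'. h ((D \<omega> t, act f \<omega> t), e t \<omega>'))) =
      ext_expectation M (\<lambda>\<omega>. h ((D \<omega> t, act f \<omega> t), e t \<omega>))"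
proof -
  let ?P = "\<lambda>A. PiM A (\<lambda>i. vec_space (T - i))"
  \<comment> \<open>A noise path \<open>x\<close> itself plays the role of the sample point, with
    \<open>?E\<close> as coordinate process; \<open>?Y\<close> rebuilds forecast and action from
    it.\<close>
  let ?E = "\<lambda>i x. x i" and ?R = "\<lambda>A \<omega>. \<lambda>i\<in>A. e i \<omega>"
  let ?Y = "\<lambda>x. (forecast T d0 ?E x t, action f (forecast T d0 ?E x) t)"
  let ?h = "\<lambda>z. h (?Y (fst z), snd z t)"
  have ind: "indep_var (?P {..<t}) (?R {..<t}) (?P {t}) (?R {t})"
    using t by (intro indep_var_restrict[OF indep]) auto
  have forecast: "(\<lambda>x. forecast T d0 ?E x s) \<in> measurable (?P {..<t}) (vec_space (T + 1))" if "s \<le> t" for s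
    using that by (intro forecast_measurable[OF d0_space] measurable_component_singleton) auto
  have Y: "?Y \<in> measurable (?P {..<t}) (vec_space (T + 1) \<Otimes>\<^sub>M borel)"
    using forecast by (intro measurable_Pair action_measurable[OF causal t]) auto
  have "(\<lambda>z. (?Y (fst z), snd z t)) \<in>
      measurable (?P {..<t} \<Otimes>\<^sub>M ?P {t}) ((vec_space (T + 1) \<Otimes>\<^sub>M borel) \<Otimes>\<^sub>M vec_space (T - t))"
    by (rule measurable_Pair[OF measurable_compose[OF measurable_fst Y]
          measurable_compose[OF measurable_snd measurable_component_singleton]]) simp
  then have h': "?h \<in> borel_measurable (?P {..<t} \<Otimes>\<^sub>M ?P {t})"
    using h by (rule measurable_compose)
  \<comment> \<open>Cutting the noise path off before \<open>t\<close> changes neither the forecasts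
    up to \<open>t\<close> nor the action at \<open>t\<close>.\<close>
  have eq: "h ((D \<omega> t, act f \<omega> t), e t \<omega>') = ?h (?R {..<t} \<omega>, ?R {t} \<omega>')" for \<omega> \<omega>'
  proof -
    have "D \<omega> s = forecast T d0 ?E (?R {..<t} \<omega>) s" if "s \<le> t" for s
      using that by (intro forecast_cong) simp
    then have "?Y (?R {..<t} \<omega>) = (D \<omega> t, act f \<omega> t)"
      by (auto intro!: action_cong)
    then show ?thesis by simp
  qed
  note E = ext_expectation_indep_var[OF ind h' ext[unfolded eq]]
  show "has_ext_expectation M (\<lambda>\<omega>. ext_expectation M (\<lambda>\<omega>'. h ((D \<omega> t, act f \<omega> t), e t \<omega>')))"
    "ext_expectation M (\<lambda>\<omega>. ext_expectation M (\<lambda>\<omega>'. h ((D \<omega> t, act f \<omega> t), e t \<omega>'))) =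
      ext_expectation M (\<lambda>\<omega>. h ((D \<omega> t, act f \<omega> t), e t \<omega>))"
    unfolding eq by (fact E)+
qed

section \<open>The Bellman recursion in expectation\<close>

text \<open>Tower property: averaging the next cost-to-go over \<open>e t\<close> first, with
  forecast and action held fixed, gives the continuation term of \<open>Q\<close>.\<close>

lemma Q_along_expectation:
  assumes f: "feasible f" and t: "t < T" and J: "has_ext_expectation M (J_along f (Suc t))"
  shows Q_along_has_expectation: "has_ext_expectation M (Q_along f t)"
    and "ext_expectation M (Q_along f t) =
      ext_expectation M (cost f t) + ext_expectation M (J_along f (Suc t))"
proof -
  let ?X = "\<lambda>\<omega>. (D \<omega> t, act f \<omega> t)"
  let ?h = "\<lambda>z. J (Suc t) (forecast_step T t (fst (fst z)) (snd z)) (snd (fst z))"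
  have causal: "causal_policy T f"
    using f by (simp add: feasible_policy_def)
  have h: "?h \<in> borel_measurable ((vec_space (T + 1) \<Otimes>\<^sub>M borel) \<Otimes>\<^sub>M vec_space (T - t))"
    using t by (intro J_step_measurable J_measurable) auto
  \<comment> \<open>The previous level at \<open>Suc t\<close> is the action at \<open>t\<close>, so
    the next state is a function of the current pair and \<open>e t\<close>.\<close>
  have J_eq: "J_along f (Suc t) = (\<lambda>\<omega>. ?h (?X \<omega>, e t \<omega>))"
    by (simp add: J_along_def previous_def fun_eq_iff)
  have Q_eq: "Q_along f t = (\<lambda>\<omega>. cost f t \<omega> + ext_expectation M (\<lambda>\<omega>'. ?h (?X \<omega>, e t \<omega>')))"
    by (simp add: Q_along_def Q_eq stage_cost_def Let_def fun_eq_iff)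
  note K = ext_expectation_state_noise[OF causal t h J[unfolded J_eq]]
  note QK = ext_expectation_add[OF stage_costs_well_defined[OF f t] K(1)]
  show "has_ext_expectation M (Q_along f t)"
    unfolding Q_eq by (rule QK(1))
  show "ext_expectation M (Q_along f t) =
      ext_expectation M (cost f t) + ext_expectation M (J_along f (Suc t))"
    unfolding Q_eq J_eq QK(2) K(2) ..
qed

lemma J_along_eq_Q_along_threshold:
  assumes f: "feasible f" and t: "t < T" and \<omega>: "\<omega> \<in> space M"
    and threshold: "act f \<omega> t = \<mu> t (D \<omega> t) (previous ginit (act f \<omega>) t)"
  shows "J_along f t \<omega> = Q_along f t \<omega>"
proof -
  have "0 \<le> previous ginit (act f \<omega>) t"
    using f \<omega> t by (intro previous_nonneg feasibleD) auto
  then show ?thesis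
    unfolding J_along_def Q_along_def threshold
    using ramps_nonneg by (intro J_eq_Q_threshold[OF t D_space Q_convex[OF t D_space]]) simp
qed

text \<open>The cost-to-go along \<open>f\<close> at stage \<open>t\<close> involves only the actions before \<open>t\<close>, so \<open>f\<close> may be
  replaced by a feasible policy that uses the threshold from stage \<open>t\<close> on. This transfers the
  integrability of the negative part from the stage costs to the cost-to-go.\<close>

lemma J_along_has_expectation:
  assumes "t \<le> T" "feasible f"
  shows "has_ext_expectation M (J_along f t)"
  using assms
proof (induction arbitrary: f rule: inc_induct)
  case base
  then show ?case by (simp add: J_along_def[abs_def] J_terminal has_ext_expectation_zero)
next
  case (step t)
  let ?f = "splice f t"
  have f': "feasible ?f"
    using step.prems by (rule splice_feasible)
  have "J_along f t \<omega> = Q_along ?f t \<omega>" if "\<omega> \<in> space M" for \<omega>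
  proof -
    have "previous ginit (act f \<omega>) t = previous ginit (act ?f \<omega>) t"
      by (intro previous_cong) (simp add: action_splice_before)
    then have "J_along f t \<omega> = J_along ?f t \<omega>"
      by (simp add: J_along_def)
    also have "\<dots> = Q_along ?f t \<omega>"
      using f' \<open>t < T\<close> that by (intro J_along_eq_Q_along_threshold action_splice_after) auto
    finally show ?thesis .
  qed
  then have "has_ext_expectation M (J_along f t) \<longleftrightarrow> has_ext_expectation M (Q_along ?f t)"
    by (rule ext_expectation_cong)
  \<comment> \<open>The induction hypothesis is needed for the spliced policy, hence the
    generalization over \<open>f\<close>.\<close>
  with Q_along_has_expectation[OF f' \<open>t < T\<close> step.IH[OF f']] show ?case by simp
qed

lemma J_along_expectation_le:
  assumes "t \<le> T" "feasible f"
  shows "ext_expectation M (J_along f t) \<le> (\<Sum>s\<in>{t..<T}. ext_expectation M (cost f s))"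
  using assms(1)
proof (induction rule: inc_induct)
  case base
  then show ?case by (simp add: J_along_def[abs_def] J_terminal ext_expectation_zero)
next
  case (step t)
  have J': "has_ext_expectation M (J_along f (Suc t))"
    using step.hyps assms(2) by (intro J_along_has_expectation) auto
  \<comment> \<open>The action of \<open>f\<close> is feasible, so it competes in the infimum that
    defines \<open>J\<close>.\<close>
  have "ext_expectation M (J_along f t) \<le> ext_expectation M (Q_along f t)"
    using step.hyps assms(2) J'
    by (intro ext_expectation_mono J_along_has_expectation Q_along_has_expectation)
      (auto simp: J_along_def Q_along_def J_eq_INF intro!: INF_lower feasibleD)
  also have "\<dots> = ext_expectation M (cost f t) + ext_expectation M (J_along f (Suc t))"
    using assms(2) step.hyps(2) J' by (rule Q_along_expectation)
  also have "\<dots> \<le> ext_expectation M (cost f t) + (\<Sum>s\<in>{Suc t..<T}. ext_expectation M (cost f s))"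
    by (intro add_left_mono step.IH)
  also have "\<dots> = (\<Sum>s\<in>{t..<T}. ext_expectation M (cost f s))"
    using step.hyps by (simp add: sum.atLeast_Suc_lessThan)
  finally show ?case .
qed

lemma J_along_expectation_threshold:
  assumes "t \<le> T" and f: "f = threshold_policy rdown rup ginit S"
  shows "ext_expectation M (J_along f t) = (\<Sum>s\<in>{t..<T}. ext_expectation M (cost f s))"
  using assms(1)
proof (induction rule: inc_induct)
  case base
  then show ?case by (simp add: J_along_def[abs_def] J_terminal ext_expectation_zero)
next
  case (step t)
  have feasible: "feasible f"
    using splice_feasible[of 0 f] by (simp add: f splice_0)
  \<comment> \<open>Splicing at time 0 makes every action a threshold action.\<close>
  have threshold: "act f \<omega> s = \<mu> s (D \<omega> s) (previous ginit (act f \<omega>) s)" for \<omega> s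
    using action_splice_after[of 0 s f "D \<omega>"] by (simp add: f splice_0)
  have J': "has_ext_expectation M (J_along f (Suc t))"
    using step.hyps feasible by (intro J_along_has_expectation) auto
  have "ext_expectation M (J_along f t) = ext_expectation M (Q_along f t)"
    using step.hyps feasible threshold
    by (intro ext_expectation_cong J_along_eq_Q_along_threshold)
  also have "\<dots> = ext_expectation M (cost f t) + ext_expectation M (J_along f (Suc t))"
    using feasible step.hyps(2) J' by (rule Q_along_expectation)
  also have "\<dots> = (\<Sum>s\<in>{t..<T}. ext_expectation M (cost f s))"
    using step.hyps by (simp add: step.IH sum.atLeast_Suc_lessThan)
  finally show ?case .
qed

section \<open>Optimality\<close>

lemma expected_cost_eq_sum:
  assumes "feasible f"
  shows "expected_cost T c \<psi> d0 M e f = (\<Sum>t\<in>{0..<T}. ext_expectation M (cost f t))"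
  unfolding expected_cost_def using assms stage_costs_well_defined
  by (subst ext_expectation_sum) (auto simp: atLeast0LessThan)

lemma threshold_policy_optimal:
  "optimal_policy T c rdown rup ginit \<psi> d0 M e (threshold_policy rdown rup ginit S)"
  unfolding optimal_policy_def
proof (intro conjI allI impI)
  let ?f = "threshold_policy rdown rup ginit S"
  show f: "feasible ?f"
    using splice_feasible[of 0 ?f] by (simp add: splice_0)
  fix f' assume f': "feasible f'"
  \<comment> \<open>At time 0 no action has been taken: the state is \<open>d0\<close> with level
    \<open>ginit\<close> under every policy, so both expected costs are compared with the same
    number.\<close>
  have "J_along ?f 0 = J_along f' 0"
    by (simp add: J_along_def fun_eq_iff previous_def)
  with J_along_expectation_threshold[of 0, OF _ refl] J_along_expectation_le[of 0, OF _ f']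
  show "expected_cost T c \<psi> d0 M e ?f \<le> expected_cost T c \<psi> d0 M e f'"
    by (simp add: expected_cost_eq_sum f f')
qed

end

theorem mainTheorem1:
  fixes T :: nat
    and c rdown rup ginit :: real
    and d0 :: "nat \<Rightarrow> real"
    and M :: "'w measure"
    and e :: "nat \<Rightarrow> 'w \<Rightarrow> nat \<Rightarrow> real"
    and \<Sigma> :: "nat \<Rightarrow> nat \<Rightarrow> nat \<Rightarrow> real"
    and \<psi> :: "real \<Rightarrow> real \<Rightarrow> ereal"
    and S :: "nat \<Rightarrow> (nat \<Rightarrow> real) \<Rightarrow> real"
  assumes "T \<ge> 1" and "c > 0" and "rdown > 0" and "rup > 0" and "ginit \<ge> 0"
    and "d0 \<in> space (vec_space (T + 1))"
    and "prob_space M"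
    and gaussian: "\<And>t. t < T \<Longrightarrow> zero_mean_gaussian_vector M (T - t) (\<Sigma> t) (e t)"
    and indep: "prob_space.indep_vars M (\<lambda>t. vec_space (T - t)) e {..<T}"
    and psi_measurable: "(\<lambda>(d, g). \<psi> d g) \<in> borel_measurable (borel \<Otimes>\<^sub>M borel)"
    and psi_proper: "\<And>d g. \<psi> d g > - \<infinity>"
    and psi_convex: "\<And>d. ext_convex (\<psi> d)"
    and Q_well_defined: "\<And>t d g. t < T \<Longrightarrow> d \<in> space (vec_space (T + 1)) \<Longrightarrow>
          has_ext_expectation M
            (\<lambda>\<omega>. dp_J T c rdown rup \<psi> M e (Suc t) (forecast_step T t d (e t \<omega>)) g)"
    and stage_costs_well_defined: "\<And>f t. feasible_policy T rdown rup ginit d0 M e f \<Longrightarrow> t < T \<Longrightarrow>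
          has_ext_expectation M (stage_cost T c \<psi> d0 e f t)"
    and S_measurable: "\<And>t. t < T \<Longrightarrow> S t \<in> borel_measurable (vec_space (T + 1))"
    and S_argmin: "\<And>t d. t < T \<Longrightarrow> d \<in> space (vec_space (T + 1)) \<Longrightarrow>
          is_arg_min (dp_Q T c rdown rup \<psi> M e t d) (\<lambda>g. True) (S t d)"
  shows "optimal_policy T c rdown rup ginit \<psi> d0 M e (threshold_policy rdown rup ginit S)"
proof -
  interpret prob_space M by fact
  interpret ramp_dispatch M T c rdown rup ginit d0 e \<psi> S
    using assms by unfold_locales auto
  show ?thesis by (rule threshold_policy_optimal)
qed

end
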